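(* Let $X$ and $Y$ be random elements on a probability space $(\Omega,\mathcal F,P)$ taking values in measurable spaces $(\Omega_X,\mathcal F_X)$ and $(\Omega_Y,\mathcal F_Y)$, respectively. Suppose that the family of probability measures $\{P_{X|Y}(\cdot\,|\,y): y\in\Omega_Y\}$ is dominated by a $\sigma$-finite measure. Then there is a unique sub $\sigma$-field $\mathcal G^*$ of $\sigma(X)$ such that: (1) $Y \perp\!\!\!\perp X \mid \mathcal G^*$; (2) if $\mathcal G$ is a sub $\sigma$-field of $\sigma(X)$ such that $Y\perp\!\!\!\perp X\mid\mathcal G$, then $\mathcal G^*\subseteq\mathcal G$.
   Context: $\sigma(X)=X^{-1}(\mathcal F_X)$ is the $\sigma$-field generated by $X$. The pair $(X,Y)$ takes values in $\Omega_X\times\Omega_Y$ with the product $\sigma$-field $\mathcal F_X\times\mathcal F_Y$. The distributions $P_X,P_Y,P_{XY}$ of $X$, $Y$, $(X,Y)$ are assumed to be dominated by $\sigma$-finite measures. $P_{X|Y}(\cdot\,|\,y)$ is the conditional distribution of $X$ given $Y=y$, a probability measure on $\Omega_X$. $Y\perp\!\!\!\perp X\mid\mathcal G$ means that $Y$ and $X$ are independent given the $\sigma$-field $\mathcal G$.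
   Formalization: The inclusion of G* in G and the uniqueness of G* are understood modulo P-null sets; with literal inclusion the claim fails, e.g. for X uniform on [0,1] and Y given X Bernoulli(X). *)

theory Defs
  imports "HOL-Probability.Probability"
begin

text \<open>
  As in the library, a \<open>\<sigma>\<close>-field on the sample space is represented by a measure of which only
  \<open>space\<close> and \<open>sets\<close> matter, and \<open>subalgebra M G\<close> says that \<open>G\<close> is a sub \<open>\<sigma>\<close>-field of \<open>M\<close>.
\<close>

definition sigma_rv :: "'a measure \<Rightarrow> 'b measure \<Rightarrow> ('a \<Rightarrow> 'b) \<Rightarrow> 'a measure" where
  "sigma_rv M N X = vimage_algebra (space M) X N"

definition cond_indep_rv ::
  "'a measure \<Rightarrow> 'a measure \<Rightarrow> 'b measure \<Rightarrow> ('a \<Rightarrow> 'b) \<Rightarrow> 'c measure \<Rightarrow> ('a \<Rightarrow> 'c) \<Rightarrow> bool" where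
  "cond_indep_rv M G N1 U N2 V \<longleftrightarrow>
     (\<forall>A \<in> sets N1. \<forall>B \<in> sets N2. AE \<omega> in M.
        real_cond_exp M G (indicator (U -` A \<inter> V -` B \<inter> space M)) \<omega>
        = real_cond_exp M G (indicator (U -` A \<inter> space M)) \<omega>
          * real_cond_exp M G (indicator (V -` B \<inter> space M)) \<omega>)"

definition is_cond_distr ::
  "'a measure \<Rightarrow> 'b measure \<Rightarrow> ('a \<Rightarrow> 'b) \<Rightarrow> 'c measure \<Rightarrow> ('a \<Rightarrow> 'c) \<Rightarrow> ('c \<Rightarrow> 'b measure) \<Rightarrow> bool" where
  "is_cond_distr M MX X MY Y K \<longleftrightarrow>
     K \<in> measurable MY (prob_algebra MX) \<and>
     (\<forall>A \<in> sets MX. \<forall>B \<in> sets MY.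
        emeasure M (X -` A \<inter> Y -` B \<inter> space M)
        = (\<integral>\<^sup>+y\<in>B. emeasure (K y) A \<partial>distr M MY Y))"

definition dominated :: "'a measure \<Rightarrow> 'a measure set \<Rightarrow> bool" where
  "dominated N \<P> \<longleftrightarrow>
     (\<exists>\<nu>. sigma_finite_measure \<nu> \<and> sets \<nu> = sets N \<and> (\<forall>Q\<in>\<P>. absolutely_continuous \<nu> Q))"

text \<open>
  Inclusion and equality of \<open>\<sigma>\<close>-fields modulo \<open>M\<close>-null sets. As usual for minimal sufficient
  \<open>\<sigma>\<close>-fields, statements about the smallest such \<open>\<sigma>\<close>-field have to be read in this sense: with
  literal inclusion of set systems no smallest one exists in general, because modifying a
  generating function on a null set gives another sufficient \<open>\<sigma>\<close>-field.
\<close>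

definition sets_le_mod_null :: "'a measure \<Rightarrow> 'a measure \<Rightarrow> 'a measure \<Rightarrow> bool" where
  "sets_le_mod_null M G H \<longleftrightarrow> (\<forall>A \<in> sets G. \<exists>B \<in> sets H. sym_diff A B \<in> null_sets M)"

definition sets_eq_mod_null :: "'a measure \<Rightarrow> 'a measure \<Rightarrow> 'a measure \<Rightarrow> bool" where
  "sets_eq_mod_null M G H \<longleftrightarrow> sets_le_mod_null M G H \<and> sets_le_mod_null M H G"

definition minimal_sdr_field ::
  "'a measure \<Rightarrow> 'b measure \<Rightarrow> ('a \<Rightarrow> 'b) \<Rightarrow> 'c measure \<Rightarrow> ('a \<Rightarrow> 'c) \<Rightarrow> 'a measure \<Rightarrow> bool" where
  "minimal_sdr_field M MX X MY Y G \<longleftrightarrow>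
     subalgebra (sigma_rv M MX X) G \<and>
     cond_indep_rv M G MY Y MX X \<and>
     (\<forall>H. subalgebra (sigma_rv M MX X) H \<and> cond_indep_rv M H MY Y MX X
          \<longrightarrow> sets_le_mod_null M G H)"

end

theory Submission
  imports Defs
begin

text \<open>
  Write \<open>f\<^sub>B\<close> for the conditional probability of \<open>Y \<in> B\<close> given \<open>\<sigma>(X)\<close>. A sub \<open>\<sigma>\<close>-field \<open>G\<close> of
  \<open>\<sigma>(X)\<close> makes \<open>Y\<close> and \<open>X\<close> conditionally independent exactly when conditioning on \<open>G\<close> instead of
  \<open>\<sigma>(X)\<close> loses nothing about \<open>Y\<close>, that is, when every \<open>f\<^sub>B\<close> agrees almost surely with a
  \<open>G\<close>-measurable function (\<open>cond_prob_eq_if_cond_indep_rv\<close> and, for \<open>f\<^sub>B\<close> that are themselves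
  \<open>G\<close>-measurable, \<open>cond_indep_rv_if_cond_prob_measurable\<close>). The smallest \<open>\<sigma>\<close>-field with this
  property should therefore be the one generated by all the \<open>f\<^sub>B\<close>, and it is.

  Any versions of the \<open>f\<^sub>B\<close> will do, although there may be uncountably many and their exceptional
  null sets need not have a null union. Inclusion is taken modulo null sets, and the sets that
  differ from a set of \<open>H\<close> by a null set form a \<open>\<sigma>\<close>-field (\<open>sets_le_mod_null_sigma\<close>), so each
  generating set \<open>{\<omega>. f\<^sub>B \<omega> \<in> C}\<close> can be treated on its own. If \<open>H\<close> satisfies the conditional
  independence, this set differs by a null set from \<open>{\<omega>. h \<omega> \<in> C}\<close>, where \<open>h\<close> is the conditional
  probability of \<open>Y \<in> B\<close> given \<open>H\<close>, and the latter set lies in \<open>H\<close>. Uniqueness is immediate from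
  minimality of both candidates.
\<close>

section \<open>Inclusion modulo null sets\<close>

lemma sym_diff_vimage_null_if_AE_eq:
  assumes "AE x in M. f x = g x"
    and "f \<in> measurable M N" and "g \<in> measurable M N" and "C \<in> sets N"
  shows "sym_diff (f -` C \<inter> space M) (g -` C \<inter> space M) \<in> null_sets M"
proof (rule AE_iff_null_sets[THEN iffD2])
  have "f -` C \<inter> space M \<in> sets M" "g -` C \<inter> space M \<in> sets M"
    using assms(2-4) by (auto intro: measurable_sets)
  then show "sym_diff (f -` C \<inter> space M) (g -` C \<inter> space M) \<in> sets M"
    by blast
  show "AE x in M. x \<notin> sym_diff (f -` C \<inter> space M) (g -` C \<inter> space M)"
    using assms(1) by eventually_elim auto
qed

text \<open>
  The sets that agree with a set of \<open>H\<close> up to a null set are closed under complements and countable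
  unions, so inclusion modulo null sets can be tested on any family of generators, however large.
\<close>

lemma sets_le_mod_null_sigma:
  assumes H: "subalgebra M H"
    and \<A>: "\<A> \<subseteq> sets M"
    and gen: "\<And>A. A \<in> \<A> \<Longrightarrow> \<exists>B\<in>sets H. sym_diff A B \<in> null_sets M"
  shows "sets_le_mod_null M (sigma (space M) \<A>) H"
  unfolding sets_le_mod_null_def
proof
  have space_H: "space H = space M" and sets_H: "sets H \<subseteq> sets M"
    using H by (simp_all add: subalgebra_def)
  have \<A>_Pow: "\<A> \<subseteq> Pow (space M)"
    using \<A> sets.space_closed by blast
  have sets_M: "A \<in> sets M" if "A \<in> sigma_sets (space M) \<A>" for A
    using that sets.sigma_sets_subset[OF \<A>] by blast
  fix A assume "A \<in> sets (sigma (space M) \<A>)"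
  then have "A \<in> sigma_sets (space M) \<A>"
    using \<A>_Pow by simp
  then show "\<exists>B\<in>sets H. sym_diff A B \<in> null_sets M"
  proof induction
    case (Basic A)
    then show ?case by (rule gen)
  next
    case Empty
    show ?case by (rule bexI[of _ "{}"]) auto
  next
    case (Compl A)
    then obtain B where B: "B \<in> sets H" "sym_diff A B \<in> null_sets M" by blast
    have "A \<subseteq> space M"
      using sets_M[OF Compl.hyps] by (rule sets.sets_into_space)
    moreover have "B \<subseteq> space M"
      using B(1) sets_H sets.sets_into_space by blast
    ultimately have "sym_diff (space M - A) (space M - B) = sym_diff A B"
      by blast
    moreover have "space M - B \<in> sets H"
      using B(1) space_H sets.compl_sets[of B H] by simp
    ultimately show ?case
      using B(2) by metis
  next
    case (Union A)
    then obtain B where B: "\<And>i. B i \<in> sets H" "\<And>i. sym_diff (A i) (B i) \<in> null_sets M"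
      by metis
    have "(\<Union>i. B i) \<in> sets H"
      using B(1) by auto
    moreover have "sym_diff (\<Union>i. A i) (\<Union>i. B i) \<in> null_sets M"
    proof (rule null_sets_subset)
      show "(\<Union>i. sym_diff (A i) (B i)) \<in> null_sets M"
        using B(2) by (rule null_sets_UN)
      have "(\<Union>i. A i) \<in> sets M" "(\<Union>i. B i) \<in> sets M"
        using sets_M Union.hyps B(1) sets_H by auto
      then show "sym_diff (\<Union>i. A i) (\<Union>i. B i) \<in> sets M"
        by blast
      show "sym_diff (\<Union>i. A i) (\<Union>i. B i) \<subseteq> (\<Union>i. sym_diff (A i) (B i))"
        by blast
    qed
    ultimately show ?case by blast
  qed
qed

section \<open>Conditional independence and conditional probabilities\<close>

lemma subalgebra_sigma_rv:
  assumes "X \<in> measurable M N"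
  shows "subalgebra M (sigma_rv M N X)"
proof -
  have "sets (sigma_rv M N X) \<subseteq> sets M"
    using assms measurable_sets[OF assms] measurable_space[OF assms]
    by (auto simp: sigma_rv_def sets_vimage_algebra2 Pi_iff)
  then show ?thesis
    by (simp add: subalgebra_def sigma_rv_def)
qed

lemma sets_sigma_rv:
  assumes "X \<in> measurable M N"
  shows "sets (sigma_rv M N X) = {X -` A \<inter> space M | A. A \<in> sets N}"
  using measurable_space[OF assms] by (simp add: sigma_rv_def sets_vimage_algebra2 Pi_iff)

lemma subalgebra_trans:
  "subalgebra M F \<Longrightarrow> subalgebra F G \<Longrightarrow> subalgebra M G"
  by (auto simp: subalgebra_def)

lemma (in prob_space) sigma_finite_subalgebraI:
  assumes "subalgebra M F"
  shows "sigma_finite_subalgebra M F"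
  by (intro finite_measure_subalgebra_is_sigma_finite finite_measure_subalgebra.intro
      finite_measure_axioms finite_measure_subalgebra_axioms.intro assms)

text \<open>
  Testing the product formula against a set \<open>A \<in> \<sigma>(X)\<close> gives
  \<open>P(Y \<in> B, A) = E[P(Y \<in> B | G) P(A | G)] = E[P(Y \<in> B | G) 1\<^sub>A]\<close>. So \<open>P(Y \<in> B | G)\<close> has the
  defining property of \<open>P(Y \<in> B | \<sigma>(X))\<close>, and it is \<open>\<sigma>(X)\<close>-measurable because \<open>G \<subseteq> \<sigma>(X)\<close>.
\<close>

lemma (in prob_space) cond_prob_eq_if_cond_indep_rv:
  assumes X: "X \<in> measurable M MX" and Y: "Y \<in> measurable M MY"
    and G: "subalgebra (sigma_rv M MX X) G"
    and indep: "cond_indep_rv M G MY Y MX X"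
    and B: "B \<in> sets MY"
  shows "AE \<omega> in M. real_cond_exp M (sigma_rv M MX X) (indicator (Y -` B \<inter> space M)) \<omega>
                   = real_cond_exp M G (indicator (Y -` B \<inter> space M)) \<omega>"
proof -
  let ?F = "sigma_rv M MX X"
  let ?b = "indicator (Y -` B \<inter> space M) :: 'a \<Rightarrow> real"
  have MF: "subalgebra M ?F" using X by (rule subalgebra_sigma_rv)
  interpret F: sigma_finite_subalgebra M ?F
    using MF by (rule sigma_finite_subalgebraI)
  interpret G: sigma_finite_subalgebra M G
    using subalgebra_trans[OF MF G] by (rule sigma_finite_subalgebraI)
  have Yb[measurable]: "Y -` B \<inter> space M \<in> sets M"
    using Y B by (rule measurable_sets)
  have b: "integrable M ?b"
    using Yb by (simp add: emeasure_eq_measure)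
  let ?g = "real_cond_exp M G ?b"
  have g: "integrable M ?g"
    using b by (rule G.real_cond_exp_int)
  show ?thesis
  proof (rule F.real_cond_exp_charact)
    show "?g \<in> borel_measurable ?F"
      using G by (rule measurable_from_subalg) simp
    fix S assume "S \<in> sets ?F"
    then obtain A where A: "A \<in> sets MX" and S: "S = X -` A \<inter> space M"
      using sets_sigma_rv[OF X] by blast
    have SM[measurable]: "S \<in> sets M"
      unfolding S using X A by (rule measurable_sets)
    let ?a = "indicator S :: 'a \<Rightarrow> real"
    have eq: "indicator (Y -` B \<inter> X -` A \<inter> space M) = (\<lambda>x. ?a x * ?b x)"
      by (auto simp: S indicator_def fun_eq_iff)
    have ab: "integrable M (\<lambda>x. ?a x * ?b x)"
      using integrable_mult_indicator[OF SM b] by simp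
    have ga: "integrable M (\<lambda>x. ?g x * ?a x)"
      using integrable_mult_indicator[OF SM g] by (simp add: mult.commute)
    have "(LINT x:S|M. ?b x) = (\<integral>x. ?a x * ?b x \<partial>M)"
      by (simp add: set_lebesgue_integral_def)
    also have "\<dots> = (\<integral>x. real_cond_exp M G (\<lambda>x. ?a x * ?b x) x \<partial>M)"
      using G.real_cond_exp_int(2)[OF ab] by simp
    also have "\<dots> = (\<integral>x. ?g x * real_cond_exp M G ?a x \<partial>M)"
    proof (rule integral_cong_AE)
      show "AE x in M. real_cond_exp M G (\<lambda>x. ?a x * ?b x) x = ?g x * real_cond_exp M G ?a x"
        unfolding eq[symmetric] unfolding S using indep A B by (simp add: cond_indep_rv_def)
    qed simp_all
    also have "\<dots> = (\<integral>x. ?g x * ?a x \<partial>M)"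
      using ga by (intro G.real_cond_exp_intg) simp_all
    also have "\<dots> = (LINT x:S|M. ?g x)"
      by (simp add: set_lebesgue_integral_def mult.commute)
    finally show "(LINT x:S|M. ?b x) = (LINT x:S|M. ?g x)" .
  qed (fact b g)+
qed

text \<open>
  Conversely, if \<open>P(Y \<in> B | \<sigma>(X))\<close> is \<open>G\<close>-measurable, then conditioning in two steps
  gives \<open>P(Y \<in> B, X \<in> A | G) = E[1\<^sub>A P(Y \<in> B | \<sigma>(X)) | G]\<close>, and the conditional probability of
  \<open>Y \<in> B\<close> can be taken out of the outer expectation.
\<close>

lemma (in prob_space) cond_indep_rv_if_cond_prob_measurable:
  assumes X: "X \<in> measurable M MX" and Y: "Y \<in> measurable M MY"
    and G: "subalgebra (sigma_rv M MX X) G"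
    and meas: "\<And>B. B \<in> sets MY \<Longrightarrow>
      real_cond_exp M (sigma_rv M MX X) (indicator (Y -` B \<inter> space M)) \<in> borel_measurable G"
  shows "cond_indep_rv M G MY Y MX X"
  unfolding cond_indep_rv_def
proof (intro ballI)
  fix B A assume B: "B \<in> sets MY" and A: "A \<in> sets MX"
  let ?F = "sigma_rv M MX X"
  let ?a = "indicator (X -` A \<inter> space M) :: 'a \<Rightarrow> real"
  let ?b = "indicator (Y -` B \<inter> space M) :: 'a \<Rightarrow> real"
  let ?f = "real_cond_exp M ?F ?b"
  have MF: "subalgebra M ?F" using X by (rule subalgebra_sigma_rv)
  interpret F: sigma_finite_subalgebra M ?F
    using MF by (rule sigma_finite_subalgebraI)
  interpret G: sigma_finite_subalgebra M G
    using subalgebra_trans[OF MF G] by (rule sigma_finite_subalgebraI)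
  have Yb[measurable]: "Y -` B \<inter> space M \<in> sets M"
    using Y B by (rule measurable_sets)
  have Xa[measurable]: "X -` A \<inter> space M \<in> sets M"
    using X A by (rule measurable_sets)
  have aF: "?a \<in> borel_measurable ?F"
    using A sets_sigma_rv[OF X] by (intro borel_measurable_indicator) blast
  have b: "integrable M ?b"
    using Yb by (simp add: emeasure_eq_measure)
  have f: "integrable M ?f"
    using b by (rule F.real_cond_exp_int)
  have ab: "integrable M (\<lambda>x. ?a x * ?b x)"
    using integrable_mult_indicator[OF Xa b] by simp
  have fa: "integrable M (\<lambda>x. ?f x * ?a x)"
    using integrable_mult_indicator[OF Xa f] by (simp add: mult.commute)
  have eq: "indicator (Y -` B \<inter> X -` A \<inter> space M) = (\<lambda>x. ?a x * ?b x)"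
    by (auto simp: indicator_def fun_eq_iff)
  have "AE x in M. real_cond_exp M ?F (\<lambda>x. ?a x * ?b x) x = ?f x * ?a x"
    using F.real_cond_exp_mult[OF aF _ ab] by (simp add: mult.commute)
  then have "AE x in M. real_cond_exp M G (real_cond_exp M ?F (\<lambda>x. ?a x * ?b x)) x
      = real_cond_exp M G (\<lambda>x. ?f x * ?a x) x"
    by (rule G.real_cond_exp_cong) simp_all
  moreover have "AE x in M. real_cond_exp M G (real_cond_exp M ?F (\<lambda>x. ?a x * ?b x)) x
      = real_cond_exp M G (\<lambda>x. ?a x * ?b x) x"
    using MF G ab by (rule G.real_cond_exp_nested_subalg)
  moreover have "AE x in M. real_cond_exp M G (\<lambda>x. ?f x * ?a x) x
      = ?f x * real_cond_exp M G ?a x"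
    using meas[OF B] _ fa by (rule G.real_cond_exp_mult) simp
  moreover have "AE x in M. real_cond_exp M G ?f x = real_cond_exp M G ?b x"
    using MF G b by (rule G.real_cond_exp_nested_subalg)
  moreover have "AE x in M. real_cond_exp M G ?f x = ?f x"
    using f meas[OF B] by (rule G.real_cond_exp_F_meas)
  ultimately show "AE x in M. real_cond_exp M G (indicator (Y -` B \<inter> X -` A \<inter> space M)) x
      = real_cond_exp M G ?b x * real_cond_exp M G ?a x"
    unfolding eq by eventually_elim simp
qed

section \<open>The \<open>\<sigma>\<close>-field generated by the conditional probabilities\<close>

text \<open>
  The generators are built from the particular versions that \<open>real_cond_exp\<close> selects. These are
  measurable with respect to \<open>\<sigma>(X)\<close> everywhere and not just up to a null set, so the generated
  \<open>\<sigma>\<close>-field is literally contained in \<open>\<sigma>(X)\<close>.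
\<close>

definition cond_prob_field ::
  "'a measure \<Rightarrow> 'b measure \<Rightarrow> ('a \<Rightarrow> 'b) \<Rightarrow> 'c measure \<Rightarrow> ('a \<Rightarrow> 'c) \<Rightarrow> 'a measure" where
  "cond_prob_field M MX X MY Y = sigma (space M)
     (\<Union>B\<in>sets MY. {real_cond_exp M (sigma_rv M MX X) (indicator (Y -` B \<inter> space M)) -` C \<inter> space M
        | C. C \<in> sets borel})"

text \<open>
  Sufficiency holds because every conditional probability is measurable with respect to the
  generated \<open>\<sigma>\<close>-field. For minimality, a competitor \<open>H\<close> supplies, for each \<open>B\<close>, an
  \<open>H\<close>-measurable function that is almost surely equal to the conditional probability of \<open>Y \<in> B\<close>, and
  the preimages of a Borel set under the two functions differ by a null set.
\<close>

lemma (in prob_space) minimal_sdr_field_cond_prob_field: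
  assumes X: "X \<in> measurable M MX" and Y: "Y \<in> measurable M MY"
  shows "minimal_sdr_field M MX X MY Y (cond_prob_field M MX X MY Y)"
proof -
  let ?F = "sigma_rv M MX X"
  let ?f = "\<lambda>B. real_cond_exp M ?F (indicator (Y -` B \<inter> space M))"
  let ?\<A> = "\<Union>B\<in>sets MY. {?f B -` C \<inter> space M | C. C \<in> sets borel}"
  let ?G = "cond_prob_field M MX X MY Y"
  have G_eq: "?G = sigma (space M) ?\<A>"
    by (simp add: cond_prob_field_def)
  have MF: "subalgebra M ?F" using X by (rule subalgebra_sigma_rv)
  have space_F: "space ?F = space M" and sets_F: "sets ?F \<subseteq> sets M"
    using MF by (simp_all add: subalgebra_def)
  have \<A>_F: "?\<A> \<subseteq> sets ?F"
    using measurable_sets[OF borel_measurable_cond_exp[of M ?F]] space_F by auto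
  have \<A>_Pow: "?\<A> \<subseteq> Pow (space M)" by blast
  have G: "subalgebra ?F ?G"
    using sets.sigma_sets_subset[OF \<A>_F] space_F \<A>_Pow
    by (simp add: subalgebra_def G_eq)
  have "?f B \<in> borel_measurable ?G" if "B \<in> sets MY" for B
  proof (rule measurableI)
    fix C :: "real set" assume "C \<in> sets borel"
    then have "?f B -` C \<inter> space M \<in> ?\<A>" using that by blast
    then show "?f B -` C \<inter> space ?G \<in> sets ?G"
      using \<A>_Pow by (simp add: G_eq sigma_sets.Basic)
  qed simp
  then have indep: "cond_indep_rv M ?G MY Y MX X"
    by (rule cond_indep_rv_if_cond_prob_measurable[OF X Y G])
  have "sets_le_mod_null M ?G H"
    if H: "subalgebra ?F H" and indep_H: "cond_indep_rv M H MY Y MX X" for H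
    unfolding G_eq
  proof (rule sets_le_mod_null_sigma)
    show MH: "subalgebra M H" using MF H by (rule subalgebra_trans)
    show "?\<A> \<subseteq> sets M" using \<A>_F sets_F by (rule order_trans)
    fix S assume "S \<in> ?\<A>"
    then obtain B and C :: "real set" where B: "B \<in> sets MY" and C: "C \<in> sets borel"
      and S: "S = ?f B -` C \<inter> space M"
      by blast
    let ?h = "real_cond_exp M H (indicator (Y -` B \<inter> space M))"
    have "?h -` C \<inter> space M \<in> sets H"
      using measurable_sets[OF borel_measurable_cond_exp[of M H] C] MH
      by (simp add: subalgebra_def)
    moreover have "sym_diff S (?h -` C \<inter> space M) \<in> null_sets M"
      unfolding S
      using cond_prob_eq_if_cond_indep_rv[OF X Y H indep_H B] _ _ C
      by (rule sym_diff_vimage_null_if_AE_eq) simp_all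
    ultimately show "\<exists>T\<in>sets H. sym_diff S T \<in> null_sets M" by blast
  qed
  then show ?thesis
    using G indep by (simp add: minimal_sdr_field_def)
qed

lemma minimal_sdr_field_unique:
  assumes "minimal_sdr_field M MX X MY Y G" and "minimal_sdr_field M MX X MY Y G'"
  shows "sets_eq_mod_null M G' G"
  using assms by (simp add: minimal_sdr_field_def sets_eq_mod_null_def)

theorem theorem1:
  fixes M :: "'a measure" and MX :: "'b measure" and MY :: "'c measure"
    and X :: "'a \<Rightarrow> 'b" and Y :: "'a \<Rightarrow> 'c" and K :: "'c \<Rightarrow> 'b measure"
  assumes "prob_space M"
    and "X \<in> measurable M MX"
    and "Y \<in> measurable M MY"
    and "dominated MX {distr M MX X}"
    and "dominated MY {distr M MY Y}"
    and "dominated (MX \<Otimes>\<^sub>M MY) {distr M (MX \<Otimes>\<^sub>M MY) (\<lambda>\<omega>. (X \<omega>, Y \<omega>))}"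
    and "is_cond_distr M MX X MY Y K"
    and "dominated MX (K ` space MY)"
  shows "\<exists>G. minimal_sdr_field M MX X MY Y G \<and>
             (\<forall>G'. minimal_sdr_field M MX X MY Y G' \<longrightarrow> sets_eq_mod_null M G' G)"
proof -
  interpret prob_space M by fact
  have "minimal_sdr_field M MX X MY Y (cond_prob_field M MX X MY Y)"
    using assms(2,3) by (rule minimal_sdr_field_cond_prob_field)
  then show ?thesis
    using minimal_sdr_field_unique by blast
qed

end
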